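(* Let $n_x, n_\phi, n_m$ be positive integers, let $J:\mathbb{R}^{n_x}\to\mathbb{R}$ and $\mu:\mathbb{R}^{n_x}\to\mathbb{R}^{n_\phi}$ be continuously differentiable, let $\Sigma\in\mathbb{R}^{n_\phi\times n_\phi}$ be symmetric positive semidefinite (independent of $x$), let $M\in\mathbb{R}^{n_m\times n_\phi}$, $m\in\mathbb{R}^{n_m}$ and $\beta\in[0,1)$. For each $x\in\mathbb{R}^{n_x}$ let $\phi(x)$ be a random vector in $\mathbb{R}^{n_\phi}$ with $\phi(x)\sim\mathcal{N}(\mu(x),\Sigma)$. Consider the joint chance-constrained problem $$\text{(P)}\qquad \min_{x\in\mathbb{R}^{n_x}} J(x)\quad\text{subject to}\quad \mathbb{P}\big(M\phi(x)\le m\big)\ge\beta .$$ Let $\theta\in\mathbb{R}^{n_\phi\times n_\phi}$ be such that $\theta^\top\theta=I_{n_\phi}$ and $\theta^\top\Sigma\theta=\mathrm{diag}(\lambda_1,\dots,\lambda_{n_\phi})$. Put $\overline{M}=M\theta$ and $\overline{\mu}(x)=\theta^\top\mu(x)$, and for $1\le i\le n_m$, $1\le j\le n_\phi$ put $\sigma_{ij}=1$ if $\overline{M}_{ij}\ge 0$ and $\sigma_{ij}=2$ if $\overline{M}_{ij}<0$. Consider the deterministically constrained problem $$\text{(Q)}\qquad \min_{x,\ \{\beta_j^1,\beta_j^2\}_{j=1}^{n_\phi}} J(x)$$ over $x\in\mathbb{R}^{n_x}$ and real slack variables $\beta_j^1,\beta_j^2$, subject to $$\prod_{j=1}^{n_\phi}\big(\beta_j^1+\beta_j^2-1\big)\ge\beta,$$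 $$\beta_j^1+\beta_j^2\ge 1,\qquad j=1,\dots,n_\phi,$$ $$0\le\beta_j^\sigma\le 1,\qquad j=1,\dots,n_\phi,\ \sigma=1,2,$$ $$\sum_{j=1}^{n_\phi}\Big(\sqrt{2\lambda_j}\,\big|\overline{M}_{ij}\big|\,\mathrm{erf}^{-1}\big(2\beta_j^{\sigma_{ij}}-1\big)\Big)+\overline{M}_i\,\overline{\mu}(x)\le m_i,\qquad i=1,\dots,n_m .$$ Then any feasible solution of (Q) is a feasible solution of (P); that is, if $\big(x,\{\beta_j^1,\beta_j^2\}_{j=1}^{n_\phi}\big)$ satisfies all the constraints of (Q), then $\mathbb{P}\big(M\phi(x)\le m\big)\ge\beta$.
   Context: Vector inequalities are understood componentwise. For a matrix $A$, $A_i$ denotes its $i$th row and $A_{ij}$ its $(i,j)$ entry; $I_n$ is the $n\times n$ identity matrix. $\mathcal{N}(\mu,\Sigma)$ denotes the (possibly degenerate) multivariate normal distribution with mean $\mu$ and covariance $\Sigma$. The superscripts $1,2$ in $\beta_j^1,\beta_j^2$ are indices, not powers. $\mathrm{erf}^{-1}$ is the inverse of the error function $\mathrm{erf}(z)=\frac{2}{\sqrt{\pi}}\int_0^z e^{-t^2}\,dt$, so that the standard normal cumulative distribution function $F$ satisfies $F^{-1}(p)=\sqrt{2}\,\mathrm{erf}^{-1}(2p-1)$ for $p\in(0,1)$. It is extended by $\mathrm{erf}^{-1}(\pm1)=\pm\infty$, with the convention $0\cdot(\pm\infty)=0$; an inequality constraint whose left-hand side would contain the undefined form $\infty-\infty$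 is regarded as not satisfied. *)

theory Defs
  imports "HOL-Probability.Probability"
begin

definition continuously_differentiable ::
    "('a::real_normed_vector \<Rightarrow> 'b::real_normed_vector) \<Rightarrow> bool" where
  "continuously_differentiable f \<longleftrightarrow>
     (\<exists>f' :: 'a \<Rightarrow> 'a \<Rightarrow>\<^sub>L 'b.
        (\<forall>x. (f has_derivative blinfun_apply (f' x)) (at x)) \<and> continuous_on UNIV f')"

definition positive_semidefinite :: "real^'n^'n \<Rightarrow> bool" where
  "positive_semidefinite A \<longleftrightarrow> (\<forall>v. 0 \<le> v \<bullet> (A *v v))"

definition diag :: "real^'n \<Rightarrow> real^'n^'n" where
  "diag d = (\<chi> i j. if i = j then d $ i else 0)"

definition std_normal_vec :: "(real^'n) measure" where
  "std_normal_vec = density lborel (\<lambda>z. ennreal (\<Prod>i\<in>UNIV. std_normal_density (z $ i)))"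

text \<open>
  A random vector has the law \<open>N(\<mu>, \<Sigma>)\<close> if it is distributed as \<open>\<mu> + A Z\<close>, where \<open>Z\<close> is a
  standard normal vector and \<open>A A\<^sup>T = \<Sigma>\<close>. The law does not depend on the choice of \<open>A\<close>, and a
  square \<open>A\<close> exists for every symmetric positive semidefinite \<open>\<Sigma>\<close>, so a singular \<open>\<Sigma>\<close> is covered.
\<close>

definition normal_distributed_vec ::
    "'w measure \<Rightarrow> ('w \<Rightarrow> real^'n) \<Rightarrow> real^'n \<Rightarrow> real^'n^'n \<Rightarrow> bool" where
  "normal_distributed_vec P X \<mu> \<Sigma> \<longleftrightarrow>
     X \<in> borel_measurable P \<and>
     (\<exists>A :: real^'n^'n. A ** transpose A = \<Sigma> \<and>
        distr P borel X = distr std_normal_vec borel (\<lambda>z. \<mu> + A *v z))"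

text \<open>The interval integral is oriented, so \<open>erf\<close> is also correct for negative arguments.\<close>

definition erf :: "real \<Rightarrow> real" where
  "erf z = 2 / sqrt pi * (LBINT t=0..ereal z. exp (- t\<^sup>2))"

text \<open>Only the values on \<open>[-1, 1]\<close> are meaningful.\<close>

definition erf_inv :: "real \<Rightarrow> ereal" where
  "erf_inv p = (if p = 1 then \<infinity> else if p = -1 then -\<infinity> else ereal (inv erf p))"

record 'a minimization_problem =
  objective :: "'a \<Rightarrow> real"
  feasible :: "'a set"

definition chance_constrained_problem ::
    "'w measure \<Rightarrow> (real^'x \<Rightarrow> real) \<Rightarrow> (real^'x \<Rightarrow> 'w \<Rightarrow> real^'p) \<Rightarrow>
     real^'p^'m \<Rightarrow> real^'m \<Rightarrow> real \<Rightarrow> (real^'x) minimization_problem" where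
  "chance_constrained_problem P J \<phi> M m \<beta> =
     \<lparr>objective = J, feasible = {x. \<P>(\<omega> in P. M *v \<phi> x \<omega> \<le> m) \<ge> \<beta>}\<rparr>"

text \<open>
  The slack variable with lower index \<open>j\<close> and upper index \<open>s\<close> is \<open>b $ s $ j\<close>, where \<open>s\<close> ranges over
  the two-element type \<open>2\<close>. The arguments \<open>M'\<close> and \<open>\<mu>'\<close> are the transformed constraint matrix and
  mean.

  The last constraint is evaluated in the extended reals. There \<open>0 * (\<plusminus>\<infinity>) = 0\<close> and
  \<open>\<infinity> + (-\<infinity>) = \<infinity>\<close>, so a sum with both an \<open>\<infinity>\<close> and a \<open>-\<infinity>\<close> term equals \<open>\<infinity>\<close> and violates the
  constraint, as required.
\<close>

definition slack_index :: "real^'p^'m \<Rightarrow> 'm \<Rightarrow> 'p \<Rightarrow> 2" where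
  "slack_index M' i j = (if M' $ i $ j \<ge> 0 then 1 else 2)"

definition deterministic_problem ::
    "(real^'x \<Rightarrow> real) \<Rightarrow> real^'p \<Rightarrow> real^'p^'m \<Rightarrow> (real^'x \<Rightarrow> real^'p) \<Rightarrow>
     real^'m \<Rightarrow> real \<Rightarrow> ((real^'x) \<times> (real^'p^2)) minimization_problem" where
  "deterministic_problem J lam M' \<mu>' m \<beta> =
     \<lparr>objective = (\<lambda>(x, b). J x),
      feasible = {(x, b).
        (\<Prod>j\<in>UNIV. (b $ 1 $ j + b $ 2 $ j - 1)) \<ge> \<beta> \<and>
        (\<forall>j. b $ 1 $ j + b $ 2 $ j \<ge> 1) \<and>
        (\<forall>j s. 0 \<le> b $ s $ j \<and> b $ s $ j \<le> 1) \<and>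
        (\<forall>i. (\<Sum>j\<in>UNIV. ereal (sqrt (2 * lam $ j) * \<bar>M' $ i $ j\<bar>) *
                 erf_inv (2 * b $ (slack_index M' i j) $ j - 1))
              + ereal (M' $ i \<bullet> \<mu>' x) \<le> ereal (m $ i))}\<rparr>"

end

theory Submission
  imports Defs
begin

text \<open>
  In the eigenbasis of the covariance the problem decouples. Writing \<open>\<phi> x = \<mu> x + A Z\<close> with
  \<open>A A\<^sup>T = \<Sigma>\<close>, the matrix \<open>B = \<theta>\<^sup>T A\<close> satisfies \<open>B B\<^sup>T = diag lam\<close>: its rows are orthogonal and have
  lengths \<open>sqrt (lam j)\<close>. Normalising the nonzero rows and completing them to an orthonormal basis
  gives \<open>B = diag (sqrt lam) Q\<close> with \<open>Q\<close> orthogonal (\<open>orthogonal_factor_of_diag_gram\<close>). Since the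
  standard normal law is rotation invariant, \<open>W = Q Z\<close> is again standard normal, so \<open>\<phi> x\<close> is
  distributed as \<open>\<mu> x + \<theta> diag (sqrt lam) W\<close> with independent standard normal coordinates \<open>W j\<close>
  (\<open>distr_normal_distributed_vec_eigenbasis\<close>).

  The slack variables are probability levels: with \<open>q s j\<close> the standard normal quantile of
  \<open>b $ s $ j\<close>, consider the box of all \<open>w\<close> with \<open>- q 2 j \<le> w j \<le> q 1 j\<close> for every \<open>j\<close>. Two facts
  about this box give the theorem.

  The box lies in the event \<open>M \<phi> \<le> m\<close>. In row \<open>i\<close>, the coordinate \<open>w j\<close> enters with the coefficient
  \<open>(M \<theta>) i j * sqrt (lam j)\<close>; the sign of the entry decides whether the upper or the lower face of
  the box is the worst case, and \<open>slack_index\<close> picks exactly that face. Hence the left-hand side of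
  the deterministic constraint bounds row \<open>i\<close> from above on the whole box.

  The box has probability at least \<open>\<beta>\<close>. By independence the probability is a product
  (\<open>measure_std_normal_vec_product\<close>), and each factor is at least \<open>b $ 1 $ j + b $ 2 $ j - 1\<close> because
  the two one-sided events have probabilities \<open>b $ 1 $ j\<close> and \<open>b $ 2 $ j\<close>
  (\<open>measure_std_normal_two_sided_quantile\<close>).
\<close>

section \<open>Rotation invariance and independence of the standard normal vector\<close>

text \<open>
  Average the measure of the preimage of \<open>A\<close> over all translates by vectors of the unit ball \<open>B\<close>.
  After exchanging the integrals, translation invariance moves the translation from \<open>A\<close> to the
  ball, and the inner integral becomes the volume of the set of all \<open>y\<close> with \<open>x - f y \<in> B\<close>. This set
  is again a unit ball since \<open>f\<close> is an isometry. So \<open>vol B * vol (f -` A) = vol B * vol A\<close>, and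
  \<open>vol B\<close> cancels.
\<close>

lemma distr_lborel_orthogonal_transformation:
  fixes f :: "'a::euclidean_space \<Rightarrow> 'a"
  assumes f: "orthogonal_transformation f"
  shows "distr lborel borel f = lborel"
proof (rule measure_eqI)
  fix A assume "A \<in> sets (distr lborel borel f)"
  then have A[measurable]: "A \<in> sets borel" by simp
  define B :: "'a set" where "B = ball 0 1"
  have B[measurable]: "B \<in> sets borel" by (simp add: B_def)
  define g where "g = inv f"
  have fg: "f (g x) = x" for x
    by (simp add: g_def f orthogonal_transformation_surj surj_f_inv_f)
  have lin: "linear f" by (rule orthogonal_transformation_linear[OF f])
  have f_cont: "continuous_on UNIV f"
    using lin by (simp add: linear_continuous_on linear_conv_bounded_linear)
  have f_meas[measurable]: "f \<in> borel_measurable borel"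
    by (rule borel_measurable_continuous_onI[OF f_cont])
  have shift: "(\<integral>\<^sup>+x. h (c + x) \<partial>lborel) = (\<integral>\<^sup>+x. h x \<partial>lborel)"
    if [measurable]: "h \<in> borel_measurable borel" for h :: "'a \<Rightarrow> ennreal" and c
    by (subst (2) lborel_distr_plus[of c, symmetric]) (simp add: nn_integral_distr)
  have ball_eq: "indicator B (- f y + x) = (indicator (ball (g x) 1) y :: ennreal)" for x y
  proof -
    have "norm (- f y + x) = norm (f (g x - y))"
      using lin by (simp add: linear_diff fg)
    also have "\<dots> = norm (g x - y)"
      using f by (rule orthogonal_transformation_norm)
    finally have "norm (- f y + x) = norm (g x - y)" .
    then show ?thesis
      by (simp add: B_def indicator_def dist_norm norm_minus_commute)
  qed
  have ball_measure: "emeasure lborel (ball (g x) 1) = emeasure lborel B" for x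
    by (simp add: B_def emeasure_ball)
  have B_pos: "emeasure lborel B \<noteq> 0" and B_fin: "emeasure lborel B \<noteq> \<infinity>"
    using unit_ball_vol_pos[of "real DIM('a)"]
    by (simp_all add: B_def emeasure_ball del: unit_ball_vol_pos)
  \<comment> \<open>The chain substitutes \<open>y \<mapsto> g x + y\<close>, then, with the integrals exchanged, \<open>x \<mapsto> x - f y\<close>.\<close>
  have "emeasure lborel B * emeasure lborel (f -` A)
      = (\<integral>\<^sup>+x. \<integral>\<^sup>+y. indicator B x * indicator A (f y) \<partial>lborel \<partial>lborel)"
  proof -
    have [measurable]: "f -` A \<in> sets borel"
      using measurable_sets[OF f_meas A] by simp
    have "indicator A (f y) = (indicator (f -` A) y :: ennreal)" for y
      by (simp add: indicator_def)
    then show ?thesis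
      by (simp add: nn_integral_cmult nn_integral_multc)
  qed
  also have "\<dots> = (\<integral>\<^sup>+x. \<integral>\<^sup>+y. indicator B x * indicator A (x + f y) \<partial>lborel \<partial>lborel)"
  proof (rule nn_integral_cong)
    fix x :: 'a
    have "f (g x + y) = x + f y" for y
      using lin by (simp add: linear_add fg)
    then show "(\<integral>\<^sup>+y. indicator B x * indicator A (f y) \<partial>lborel)
      = (\<integral>\<^sup>+y. indicator B x * indicator A (x + f y) \<partial>lborel :: ennreal)"
      using shift[of "\<lambda>y. indicator B x * indicator A (f y)" "g x"] by simp
  qed
  also have "\<dots> = (\<integral>\<^sup>+y. \<integral>\<^sup>+x. indicator B x * indicator A (x + f y) \<partial>lborel \<partial>lborel)"
    by (rule lborel_pair.Fubini'[symmetric]) measurable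
  also have "\<dots> = (\<integral>\<^sup>+y. \<integral>\<^sup>+x. indicator (ball (g x) 1) y * indicator A x \<partial>lborel \<partial>lborel)"
  proof (rule nn_integral_cong)
    fix y :: 'a
    show "(\<integral>\<^sup>+x. indicator B x * indicator A (x + f y) \<partial>lborel)
      = (\<integral>\<^sup>+x. indicator (ball (g x) 1) y * indicator A x \<partial>lborel :: ennreal)"
      using shift[of "\<lambda>x. indicator B x * indicator A (x + f y)" "- f y"]
      unfolding ball_eq[symmetric] by simp
  qed
  also have "\<dots> = (\<integral>\<^sup>+x. \<integral>\<^sup>+y. indicator (ball (g x) 1) y * indicator A x \<partial>lborel \<partial>lborel)"
    unfolding ball_eq[symmetric] by (rule lborel_pair.Fubini') measurable
  also have "\<dots> = emeasure lborel B * emeasure lborel A"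
  proof -
    have "ball (g x) 1 \<in> sets lborel" for x by simp
    then have "(\<integral>\<^sup>+y. indicator (ball (g x) 1) y * indicator A x \<partial>lborel)
        = emeasure lborel B * indicator A x" for x
      by (subst nn_integral_multc) (simp_all only: nn_integral_indicator ball_measure borel_measurable_indicator)
    then show ?thesis by (simp add: nn_integral_cmult)
  qed
  finally have "emeasure lborel (f -` A) = emeasure lborel A"
    using B_pos B_fin by (simp add: ennreal_mult_cancel_left)
  then show "emeasure (distr lborel borel f) A = emeasure lborel A"
    by (simp add: emeasure_distr)
qed simp

text \<open>The density depends on the norm only, which is the source of the rotation invariance.\<close>

lemma std_normal_vec_radial:
  "(std_normal_vec :: (real^'n) measure)
     = density lborel (\<lambda>z. ennreal ((1 / sqrt (2 * pi)) ^ CARD('n) * exp (- (norm z)\<^sup>2 / 2)))"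
proof -
  have "(norm z)\<^sup>2 = (\<Sum>i\<in>UNIV. (z $ i)\<^sup>2)" for z :: "real^'n"
    by (simp add: norm_vec_def L2_set_def sum_nonneg)
  then have "(\<Prod>i\<in>UNIV. std_normal_density (z $ i))
      = (1 / sqrt (2 * pi)) ^ CARD('n) * exp (- (norm z)\<^sup>2 / 2)" for z :: "real^'n"
    by (simp add: std_normal_density_def prod_dividef exp_sum sum_divide_distrib power_divide
        flip: sum_negf)
  then show ?thesis by (simp only: std_normal_vec_def)
qed

lemma distr_std_normal_vec_orthogonal_transformation:
  fixes f :: "real^'n \<Rightarrow> real^'n"
  assumes "orthogonal_transformation f"
  shows "distr std_normal_vec borel f = std_normal_vec"
proof -
  let ?d = "\<lambda>z::real^'n. ennreal ((1 / sqrt (2 * pi)) ^ CARD('n) * exp (- (norm z)\<^sup>2 / 2))"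
  have [measurable]: "f \<in> borel_measurable borel"
    using orthogonal_transformation_linear[OF assms]
    by (intro borel_measurable_continuous_onI) (simp add: linear_continuous_on linear_conv_bounded_linear)
  have "distr std_normal_vec borel f = distr (density lborel (\<lambda>z. ?d (f z))) borel f"
    using assms by (simp only: std_normal_vec_radial orthogonal_transformation_norm)
  also have "\<dots> = density (distr lborel borel f) ?d"
    by (rule density_distr[symmetric]) measurable
  also have "\<dots> = std_normal_vec"
    by (simp only: distr_lborel_orthogonal_transformation[OF assms] std_normal_vec_radial)
  finally show ?thesis .
qed

text \<open>
  The density is a product over the coordinates, so the coordinates are independent and standard
  normal. The integral formula for \<open>lborel\<close> is indexed by the basis vectors; \<open>ix\<close> translates a basis
  vector back to the coordinate that it belongs to.
\<close>

lemma emeasure_std_normal_vec_product: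
  fixes S :: "'n::finite \<Rightarrow> real set"
  assumes S[measurable]: "\<And>i. S i \<in> sets borel"
  shows "emeasure std_normal_vec {z. \<forall>i. z $ i \<in> S i}
           = (\<Prod>i\<in>UNIV. emeasure std_normal_distribution (S i))"
proof -
  define ix :: "real^'n \<Rightarrow> 'n" where "ix = (\<lambda>b. SOME i. b = axis i 1)"
  have ix: "ix (axis i 1) = i" for i
    by (auto simp: ix_def axis_eq_axis)
  have inj: "inj (\<lambda>i::'n. axis i (1::real))"
    by (auto simp: inj_on_def axis_eq_axis)
  have Basis: "(Basis :: (real^'n) set) = range (\<lambda>i. axis i 1)"
    by (auto simp: Basis_vec_def)
  let ?f = "\<lambda>i t. ennreal (std_normal_density t) * indicator (S i) t"
  have [measurable]: "{z::real^'n. \<forall>i. z $ i \<in> S i} \<in> sets borel"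
    by measurable
  have ind: "indicator {z. \<forall>i. z $ i \<in> S i} z = (\<Prod>i\<in>UNIV. indicator (S i) (z $ i) :: ennreal)"
    for z :: "real^'n"
    by (auto simp: indicator_def)
  have "emeasure std_normal_vec {z. \<forall>i. z $ i \<in> S i}
      = (\<integral>\<^sup>+z. (\<Prod>i\<in>UNIV. ?f i (z $ i)) \<partial>lborel)"
    by (simp add: std_normal_vec_def emeasure_density ind prod_ennreal[symmetric] prod.distrib)
  also have "\<dots> = (\<integral>\<^sup>+z. (\<Prod>b\<in>Basis. ?f (ix b) (z \<bullet> b)) \<partial>lborel)"
    by (simp add: Basis prod.reindex[OF inj] ix inner_axis)
  also have "\<dots> = (\<Prod>b\<in>Basis. \<integral>\<^sup>+t. ?f (ix b) t \<partial>lborel)"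
    by (rule nn_integral_lborel_prod) auto
  also have "\<dots> = (\<Prod>i\<in>UNIV. \<integral>\<^sup>+t. ?f i t \<partial>lborel)"
    by (simp add: Basis prod.reindex[OF inj] ix)
  also have "\<dots> = (\<Prod>i\<in>UNIV. emeasure std_normal_distribution (S i))"
    by (simp add: emeasure_density)
  finally show ?thesis .
qed

lemma prob_space_std_normal_vec: "prob_space (std_normal_vec :: (real^'n) measure)"
proof
  have "emeasure (std_normal_vec :: (real^'n) measure) UNIV = 1"
    using emeasure_std_normal_vec_product[of "\<lambda>_::'n. UNIV"]
      prob_space.emeasure_space_1[OF prob_space_normal_density, of 1 0] by simp
  then show "emeasure (std_normal_vec :: (real^'n) measure) (space std_normal_vec) = 1"
    by (simp add: std_normal_vec_def)
qed

lemma measure_std_normal_vec_product: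
  fixes S :: "'n::finite \<Rightarrow> real set"
  assumes "\<And>i. S i \<in> sets borel"
  shows "measure std_normal_vec {z. \<forall>i. z $ i \<in> S i}
           = (\<Prod>i\<in>UNIV. measure std_normal_distribution (S i))"
proof -
  interpret prob_space std_normal_distribution by (rule prob_space_normal_density) simp
  show ?thesis
    using emeasure_std_normal_vec_product[of S, OF assms]
    by (simp add: emeasure_eq_measure prod_ennreal measure_def[of std_normal_vec] prod_nonneg)
qed

section \<open>Standard normal quantiles through the inverse error function\<close>

text \<open>The substitution \<open>s = sqrt 2 * t\<close> turns the normal density into the integrand of \<open>erf\<close>.\<close>

lemma cdf_std_normal_diff:
  assumes "a \<le> b"
  shows "cdf std_normal_distribution (sqrt 2 * b) - cdf std_normal_distribution (sqrt 2 * a)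
           = 1 / sqrt pi * (LBINT t=a..b. exp (- t\<^sup>2))"
proof -
  interpret real_distribution std_normal_distribution by (rule real_dist_normal_dist)
  have le: "sqrt 2 * a \<le> sqrt 2 * b" using assms by simp
  have "ennreal (cdf std_normal_distribution (sqrt 2 * b) - cdf std_normal_distribution (sqrt 2 * a))
      = ennreal (LBINT s:{sqrt 2 * a<..sqrt 2 * b}. std_normal_density s)"
  proof -
    have "integrable lborel (\<lambda>s. indicator {sqrt 2 * a<..sqrt 2 * b} s *\<^sub>R std_normal_density s)"
      by (rule integrable_mult_indicator) auto
    then have "ennreal (LBINT s:{sqrt 2 * a<..sqrt 2 * b}. std_normal_density s)
        = (\<integral>\<^sup>+s. ennreal (indicator {sqrt 2 * a<..sqrt 2 * b} s *\<^sub>R std_normal_density s) \<partial>lborel)"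
      unfolding set_lebesgue_integral_def by (subst nn_integral_eq_integral) auto
    also have "\<dots> = emeasure std_normal_distribution {sqrt 2 * a<..sqrt 2 * b}"
      by (simp add: emeasure_density ennreal_mult' ennreal_indicator mult.commute)
    finally show ?thesis by (simp only: emeasure_Ioc[OF le])
  qed
  moreover have "0 \<le> (LBINT s:{sqrt 2 * a<..sqrt 2 * b}. std_normal_density s)"
    by (simp add: set_lebesgue_integral_def)
  ultimately have "cdf std_normal_distribution (sqrt 2 * b) - cdf std_normal_distribution (sqrt 2 * a)
      = (LBINT s:{sqrt 2 * a<..sqrt 2 * b}. std_normal_density s)"
    using cdf_nondecreasing[OF le] by (simp add: ennreal_inj)
  also have "\<dots> = (LBINT s=ereal (sqrt 2 * a)..ereal (sqrt 2 * b). std_normal_density s)"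
    using le by (simp add: interval_integral_Ioc)
  also have "\<dots> = (LBINT t=a..b. sqrt 2 *\<^sub>R std_normal_density (sqrt 2 * t))"
    using assms
    by (intro interval_integral_substitution_finite[symmetric])
       (auto intro!: derivative_eq_intros continuous_intros simp: std_normal_density_def)
  also have "\<dots> = (LBINT t=a..b. 1 / sqrt pi * exp (- t\<^sup>2))"
    by (simp add: std_normal_density_def real_sqrt_mult power_mult_distrib)
  also have "\<dots> = 1 / sqrt pi * (LBINT t=a..b. exp (- t\<^sup>2))"
    by (rule interval_lebesgue_integral_mult_right)
  finally show ?thesis .
qed

lemma std_normal_distribution_reflect:
  "distr std_normal_distribution borel uminus = std_normal_distribution"
proof -
  have "distr std_normal_distribution borel uminus
      = distr (density lborel (\<lambda>x. ennreal (std_normal_density (- x)))) borel uminus"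
    by (simp add: std_normal_density_def)
  also have "\<dots> = density (distr lborel borel uminus) std_normal_density"
    by (rule density_distr[symmetric]) measurable
  finally show ?thesis by (simp add: lborel_distr_uminus)
qed

lemma measure_std_normal_reflect:
  assumes "S \<in> sets borel"
  shows "measure std_normal_distribution {w. - w \<in> S} = measure std_normal_distribution S"
proof -
  have "measure (distr std_normal_distribution borel uminus) S
      = measure std_normal_distribution (uminus -` S \<inter> space std_normal_distribution)"
    using assms by (intro measure_distr) auto
  then show ?thesis
    by (simp add: std_normal_distribution_reflect vimage_def)
qed

lemma isCont_cdf_std_normal: "isCont (cdf std_normal_distribution) x"
proof -
  interpret real_distribution std_normal_distribution by (rule real_dist_normal_dist)
  have "{x} \<in> null_sets std_normal_distribution"
    by (intro absolutely_continuousI_density[unfolded absolutely_continuous_def, THEN subsetD]) auto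
  then show ?thesis
    by (simp add: isCont_cdf measure_def null_setsD1)
qed

lemma cdf_std_normal_0: "cdf std_normal_distribution 0 = 1 / 2"
proof -
  interpret real_distribution std_normal_distribution by (rule real_dist_normal_dist)
  have "{w::real. - w \<in> {..0}} = {0..}" by auto
  then have sym: "measure std_normal_distribution {0..} = measure std_normal_distribution {..0}"
    using measure_std_normal_reflect[of "{..0}"] by simp
  have null: "measure std_normal_distribution {0} = 0"
    using isCont_cdf_std_normal by (simp flip: isCont_cdf)
  have "{..0::real} = {..<0} \<union> {0}" by auto
  then have "measure std_normal_distribution {..0} = measure std_normal_distribution {..<0}"
    using finite_measure_Union[of "{..<0}" "{0}"] null by simp
  moreover have "measure std_normal_distribution ({..<0} \<union> {0..})
      = measure std_normal_distribution {..<0} + measure std_normal_distribution {0..}"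
    by (rule finite_measure_Union) auto
  moreover have "{..<0::real} \<union> {0..} = UNIV" by auto
  ultimately show ?thesis
    using sym prob_space by (simp add: cdf_def)
qed

lemma cdf_std_normal_erf: "cdf std_normal_distribution (sqrt 2 * z) = (1 + erf z) / 2"
proof (cases "0 \<le> z")
  case True
  show ?thesis
    using cdf_std_normal_diff[OF True]
    by (simp add: cdf_std_normal_0 erf_def zero_ereal_def field_simps)
next
  case False
  then have "z \<le> 0" by simp
  show ?thesis
    using cdf_std_normal_diff[OF \<open>z \<le> 0\<close>] interval_integral_endpoints_reverse[of 0 "ereal z" "\<lambda>t. exp (- t\<^sup>2)"]
    by (simp add: cdf_std_normal_0 erf_def zero_ereal_def field_simps)
qed

text \<open>
  The distribution function is continuous with limits \<open>0\<close> and \<open>1\<close>, so every value strictly in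
  between is attained, and \<open>erf\<close> attains every value in \<open>(-1, 1)\<close>. On attained values \<open>inv erf\<close> is a
  right inverse.
\<close>

lemma erf_right_inverse:
  assumes "-1 < p" "p < 1"
  shows "erf (inv erf p) = p"
proof -
  interpret real_distribution std_normal_distribution by (rule real_dist_normal_dist)
  let ?F = "cdf std_normal_distribution"
  have "eventually (\<lambda>x. ?F x < (1 + p) / 2) at_bot" 
    using assms by (intro order_tendstoD[OF cdf_lim_at_bot]) simp
  then obtain l where l: "?F l < (1 + p) / 2" by (auto simp: eventually_at_bot_linorder)
  have "eventually (\<lambda>x. (1 + p) / 2 < ?F x) at_top" 
    using assms by (intro order_tendstoD[OF cdf_lim_at_top_prob]) simp
  then obtain u where u: "(1 + p) / 2 < ?F u" by (auto simp: eventually_at_top_linorder)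
  have "l \<le> u" using l u cdf_nondecreasing[of u l] by linarith
  then obtain t where "?F t = (1 + p) / 2"
    using IVT'[of ?F l "(1 + p) / 2" u] l u isCont_cdf_std_normal
    by (auto intro: continuous_at_imp_continuous_on)
  then have "erf (t / sqrt 2) = p"
    using cdf_std_normal_erf[of "t / sqrt 2"] by simp
  then have "p \<in> range erf" by (metis rangeI)
  then show ?thesis by (rule f_inv_into_f)
qed

text \<open>
  The infinite quantiles at the levels \<open>0\<close> and \<open>1\<close> fit in: they give the empty set and the whole line.
\<close>

lemma measure_below_std_normal_quantile:
  assumes "0 \<le> q" "q \<le> 1"
  shows "measure std_normal_distribution {w. ereal w \<le> ereal (sqrt 2) * erf_inv (2 * q - 1)} = q"
proof -
  interpret real_distribution std_normal_distribution by (rule real_dist_normal_dist)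
  consider "q = 0" | "q = 1" | "0 < q" "q < 1" using assms by linarith
  then show ?thesis
  proof cases
    case 3
    then have "{w. ereal w \<le> ereal (sqrt 2) * erf_inv (2 * q - 1)} = {..sqrt 2 * inv erf (2 * q - 1)}"
      by (auto simp: erf_inv_def)
    then show ?thesis
      using 3 cdf_std_normal_erf[of "inv erf (2 * q - 1)"] by (simp add: cdf_def erf_right_inverse)
  qed (use prob_space in \<open>simp_all add: erf_inv_def\<close>)
qed

text \<open>
  This is \<open>Pr (U \<inter> V) \<ge> Pr U + Pr V - 1\<close>, where \<open>V\<close> is reflected at the origin. Bounding
  the intersection this way treats crossing bounds (\<open>p + q < 1\<close>) and infinite quantiles uniformly.
\<close>

lemma measure_std_normal_two_sided_quantile:
  assumes "0 \<le> p" "p \<le> 1" "0 \<le> q" "q \<le> 1"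
  shows "p + q - 1 \<le> measure std_normal_distribution
           {w. ereal w \<le> ereal (sqrt 2) * erf_inv (2 * p - 1) \<and>
                ereal (- w) \<le> ereal (sqrt 2) * erf_inv (2 * q - 1)}"
proof -
  interpret real_distribution std_normal_distribution by (rule real_dist_normal_dist)
  define U where "U = {w. ereal w \<le> ereal (sqrt 2) * erf_inv (2 * p - 1)}"
  define V where "V = {w. ereal w \<le> ereal (sqrt 2) * erf_inv (2 * q - 1)}"
  have [measurable]: "U \<in> sets borel" "V \<in> sets borel" "{w. - w \<in> V} \<in> sets borel"
    unfolding U_def V_def by measurable
  have "prob (U \<union> {w. - w \<in> V}) + prob (U \<inter> {w. - w \<in> V}) = prob U + prob {w. - w \<in> V}"
    using finite_measure_Union'[of U "{w. - w \<in> V}"] finite_measure_Diff'[of "{w. - w \<in> V}" U] by (simp add: Int_commute)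
  moreover have "prob U = p" "prob {w. - w \<in> V} = q"
    using assms by (simp_all add: measure_std_normal_reflect) (simp_all add: U_def V_def measure_below_std_normal_quantile)
  moreover have "prob (U \<union> {w. - w \<in> V}) \<le> 1" by simp
  ultimately have "p + q - 1 \<le> prob (U \<inter> {w. - w \<in> V})" by linarith
  then show ?thesis by (simp add: U_def V_def Int_def)
qed

section \<open>Normal vectors in the eigenbasis of the covariance\<close>

text \<open>
  An orthonormal family indexed by a set \<open>S\<close> of coordinates can be completed to a full matrix in
  place: a basis extending the family has as many additional vectors as there are indices outside
  \<open>S\<close>, and any bijection between the two distributes them over the free rows.
\<close>

lemma orthonormal_family_extension:
  fixes e :: "'n \<Rightarrow> real^'n::finite"
  assumes norm: "\<And>i. i \<in> S \<Longrightarrow> norm (e i) = 1"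
    and orth: "\<And>i j. i \<in> S \<Longrightarrow> j \<in> S \<Longrightarrow> i \<noteq> j \<Longrightarrow> orthogonal (e i) (e j)"
  obtains Q :: "real^'n^'n" where "orthogonal_matrix Q" "\<And>i. i \<in> S \<Longrightarrow> Q $ i = e i"
proof -
  have inj: "inj_on e S"
    using norm orth by (auto simp: inj_on_def) (metis norm_zero orthogonal_self zero_neq_one)
  have pw: "pairwise orthogonal (e ` S)"
    using orth by (auto simp: pairwise_def)
  obtain U where U: "U \<inter> insert 0 (e ` S) = {}" "pairwise orthogonal (e ` S \<union> U)"
      "span (e ` S \<union> U) = span (e ` S \<union> UNIV)"
    using orthogonal_extension_strong[OF pw] by blast
  have "0 \<notin> e ` S \<union> U"
    using U(1) norm by fastforce
  then have indep: "independent (e ` S \<union> U)"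
    using U(2) by (rule pairwise_orthogonal_independent[rotated])
  then have fin: "finite (e ` S \<union> U)" by (rule independent_imp_finite)
  have "card (e ` S \<union> U) = CARD('n)"
    using indep U(3) by (metis DIM_cart DIM_real mult.right_neutral dim_UNIV dim_eq_card dim_span span_UNIV sup_top_right)
  moreover have "card (e ` S \<union> U) = card (e ` S) + card U"
    using fin U(1) by (intro card_Un_disjoint) auto
  moreover have "card (e ` S) = card S" by (rule card_image[OF inj])
  moreover have "card (- S) = CARD('n) - card S" by (simp add: Compl_eq_Diff_UNIV card_Diff_subset)
  ultimately have "card (- S) = card U" by simp
  then obtain h where h: "bij_betw h (- S) U"
    using finite_same_card_bij[of "- S" U] fin by auto
  define g where "g i = (if i \<in> S then e i else h i /\<^sub>R norm (h i))" for i
  have hU: "h i \<in> U" if "i \<notin> S" for i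
    using h that by (auto simp: bij_betw_def)
  have hh: "orthogonal (h i) (h j)" if "i \<notin> S" "j \<notin> S" "i \<noteq> j" for i j
  proof -
    have "h i \<noteq> h j" using h that by (auto simp: bij_betw_def inj_on_def)
    then show ?thesis using U(2) hU that by (auto simp: pairwise_def)
  qed
  have eh: "orthogonal (e i) (h j)" if "i \<in> S" "j \<notin> S" for i j
  proof -
    have "e i \<noteq> h j" using hU[OF that(2)] U(1) imageI[OF that(1), of e] by auto
    then show ?thesis using U(2) hU that by (auto simp: pairwise_def)
  qed
  have "norm (g i) = 1" for i
    using norm hU[of i] U(1) by (cases "h i = 0") (auto simp: g_def)
  moreover have "orthogonal (g i) (g j)" if "i \<noteq> j" for i j
    using that orth hh eh eh[THEN orthogonal_commute[THEN iffD1]]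
    by (auto simp: g_def orthogonal_clauses)
  moreover have "row i (\<chi> i. g i) = g i" for i by (simp add: row_def vec_eq_iff)
  ultimately have "orthogonal_matrix (\<chi> i. g i)"
    by (simp add: orthogonal_matrix_orthonormal_rows)
  then show ?thesis by (rule that) (simp add: g_def)
qed

lemma diag_mult_vec: "(diag d *v v) $ i = d $ i * v $ i"
  by (simp add: diag_def matrix_vector_mult_def if_distrib[of "\<lambda>x. x * _"] cong: if_cong)

text \<open>
  A zero row of \<open>B\<close> corresponds to a zero of \<open>d\<close>; the factor \<open>0\<close> in the diagonal matrix then
  annihilates the arbitrary row that \<open>Q\<close> has there. This covers degenerate covariances.
\<close>

lemma orthogonal_factor_of_diag_gram:
  fixes B :: "real^'n^'n"
  assumes "B ** transpose B = diag d"
  obtains Q where "orthogonal_matrix Q" "B = diag (\<chi> i. sqrt (d $ i)) ** Q"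
proof -
  have inner: "B $ i \<bullet> B $ j = (if i = j then d $ i else 0)" for i j
  proof -
    have "(B ** transpose B) $ i $ j = B $ i \<bullet> B $ j"
      by (simp add: matrix_matrix_mult_def transpose_def inner_vec_def)
    then show ?thesis by (simp add: assms diag_def)
  qed
  define S where "S = {i. B $ i \<noteq> 0}"
  have norm: "norm (B $ i) = sqrt (d $ i)" for i
    using inner[of i i] by (simp add: norm_eq_sqrt_inner)
  obtain Q where Q: "orthogonal_matrix Q" "\<And>i. i \<in> S \<Longrightarrow> Q $ i = B $ i /\<^sub>R norm (B $ i)"
    by (rule orthonormal_family_extension[of S "\<lambda>i. B $ i /\<^sub>R norm (B $ i)"])
       (auto simp: S_def orthogonal_def inner)
  have "(diag (\<chi> i. sqrt (d $ i)) ** Q) $ i = norm (B $ i) *\<^sub>R Q $ i" for i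
    by (simp add: vec_eq_iff matrix_matrix_mult_def diag_def norm if_distrib[of "\<lambda>x. x * _"] cong: if_cong)
  moreover have "B $ i = norm (B $ i) *\<^sub>R Q $ i" for i
    by (cases "B $ i = 0") (simp_all add: S_def Q(2))
  ultimately have "B = diag (\<chi> i. sqrt (d $ i)) ** Q"
    by (simp add: vec_eq_iff[of B])
  with Q(1) show ?thesis by (rule that)
qed

lemma gram_diag_nonneg:
  fixes B :: "real^'n^'n"
  assumes "B ** transpose B = diag d"
  shows "0 \<le> d $ j"
proof -
  have "d $ j = (B ** transpose B) $ j $ j"
    unfolding assms by (simp add: diag_def)
  also have "\<dots> = (\<Sum>k\<in>UNIV. (B $ j $ k)\<^sup>2)"
    by (simp add: matrix_matrix_mult_def transpose_def power2_eq_square)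
  finally show ?thesis by (simp add: sum_nonneg)
qed

lemma affine_borel:
  fixes C :: "real^'n^'k"
  shows "(\<lambda>z. c + C *v z) \<in> borel_measurable borel"
  by (intro borel_measurable_continuous_onI continuous_intros)

text \<open>
  With \<open>A = \<theta> D Q\<close>, the vector \<open>\<mu> + A Z\<close> is the image of \<open>Q Z\<close> under \<open>w \<mapsto> \<mu> + \<theta> D w\<close>, and \<open>Q Z\<close>
  has the same law as \<open>Z\<close>. So the law no longer depends on the unknown square root \<open>A\<close> of \<open>\<Sigma>\<close>.
\<close>

lemma distr_normal_distributed_vec_eigenbasis:
  fixes \<theta> :: "real^'n^'n"
  assumes X: "normal_distributed_vec P X \<mu> \<Sigma>"
    and \<theta>: "transpose \<theta> ** \<theta> = mat 1"
    and diag: "transpose \<theta> ** \<Sigma> ** \<theta> = diag lam"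
  shows "distr P borel X
           = distr std_normal_vec borel (\<lambda>w. \<mu> + (\<theta> ** diag (\<chi> j. sqrt (lam $ j))) *v w)"
    and "0 \<le> lam $ j"
proof -
  define D where "D = diag (\<chi> j. sqrt (lam $ j))"
  obtain A :: "real^'n^'n" where A: "A ** transpose A = \<Sigma>"
    and law: "distr P borel X = distr std_normal_vec borel (\<lambda>z. \<mu> + A *v z)"
    using X by (auto simp: normal_distributed_vec_def)
  have \<theta>': "\<theta> ** transpose \<theta> = mat 1"
    using \<theta> by (simp add: matrix_left_right_inverse)
  have cov: "(transpose \<theta> ** A) ** transpose (transpose \<theta> ** A) = diag lam"
    using diag unfolding A[symmetric] by (simp add: matrix_transpose_mul matrix_mul_assoc)
  then show "0 \<le> lam $ j" by (rule gram_diag_nonneg)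
  from cov obtain Q where Q: "orthogonal_matrix Q" and BQ: "transpose \<theta> ** A = D ** Q"
    unfolding D_def by (rule orthogonal_factor_of_diag_gram)
  have A_eq: "A = \<theta> ** D ** Q"
    using arg_cong[OF BQ, of "(**) \<theta>"] by (simp add: matrix_mul_assoc \<theta>')
  have orthQ: "orthogonal_transformation ((*v) Q)"
    using Q by (simp add: orthogonal_transformation_matrix matrix_of_matrix_vector_mul
        matrix_vector_mul_linear)
  have [measurable]: "(*v) Q \<in> measurable std_normal_vec borel"
    using affine_borel[of 0 Q] by (simp add: std_normal_vec_def)
  have [measurable]: "(\<lambda>w. \<mu> + (\<theta> ** D) *v w) \<in> borel_measurable borel"
    by (rule affine_borel)
  have "distr P borel X
      = distr (distr std_normal_vec borel ((*v) Q)) borel (\<lambda>w. \<mu> + (\<theta> ** D) *v w)"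
    unfolding law A_eq by (subst distr_distr) (simp_all add: comp_def matrix_vector_mul_assoc)
  then show "distr P borel X
      = distr std_normal_vec borel (\<lambda>w. \<mu> + (\<theta> ** diag (\<chi> j. sqrt (lam $ j))) *v w)"
    by (simp only: distr_std_normal_vec_orthogonal_transformation[OF orthQ] D_def)
qed

section \<open>Feasibility of the deterministic problem implies the chance constraint\<close>

lemma sets_borel_polyhedron:
  fixes M :: "real^'k^'m"
  shows "{y. M *v y \<le> m} \<in> sets borel"
proof -
  have "{y. M *v y \<le> m} = (\<Inter>i. {y. (M *v y) $ i \<le> m $ i})"
    by (auto simp: less_eq_vec_def)
  also have "closed \<dots>"
    by (intro closed_INT ballI closed_Collect_le continuous_on_component continuous_on_const
        linear_continuous_on matrix_vector_mul_bounded_linear)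
  finally show ?thesis by (rule borel_closed)
qed

theorem theorem1:
  fixes P :: "'w measure"
    and J :: "real^'x \<Rightarrow> real"
    and \<mu> :: "real^'x \<Rightarrow> real^'p"
    and \<Sigma> :: "real^'p^'p"
    and M :: "real^'p^'m"
    and m :: "real^'m"
    and \<beta> :: real
    and \<phi> :: "real^'x \<Rightarrow> 'w \<Rightarrow> real^'p"
    and \<theta> :: "real^'p^'p"
    and lam :: "real^'p"
    and x :: "real^'x"
    and b :: "real^'p^2"
  assumes "prob_space P"
    and "continuously_differentiable J"
    and "continuously_differentiable \<mu>"
    and "transpose \<Sigma> = \<Sigma>"
    and "positive_semidefinite \<Sigma>"
    and "0 \<le> \<beta>" and "\<beta> < 1"
    and "\<And>x. normal_distributed_vec P (\<phi> x) (\<mu> x) \<Sigma>"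
    and "transpose \<theta> ** \<theta> = mat 1"
    and "transpose \<theta> ** \<Sigma> ** \<theta> = diag lam"
    and "(x, b) \<in> feasible (deterministic_problem J lam (M ** \<theta>) (\<lambda>x. transpose \<theta> *v \<mu> x) m \<beta>)"
  shows "x \<in> feasible (chance_constrained_problem P J \<phi> M m \<beta>)"
proof -
  interpret P: prob_space P by fact
  interpret N: prob_space "std_normal_vec :: (real^'p) measure" by (rule prob_space_std_normal_vec)
  define M' where "M' = M ** \<theta>"
  define \<mu>' where "\<mu>' = transpose \<theta> *v \<mu> x"
  define D where "D = diag (\<chi> j. sqrt (lam $ j))"
  define q where "q s j = ereal (sqrt 2) * erf_inv (2 * b $ s $ j - 1)" for s j
  define I where "I j = {w. ereal w \<le> q 1 j \<and> ereal (- w) \<le> q 2 j}" for j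
  have slack_prod: "\<beta> \<le> (\<Prod>j\<in>UNIV. b $ 1 $ j + b $ 2 $ j - 1)"
    and slack_sum: "\<And>j. 1 \<le> b $ 1 $ j + b $ 2 $ j"
    and slack_bounds: "\<And>s j. 0 \<le> b $ s $ j \<and> b $ s $ j \<le> 1"
    and linear: "\<And>i. (\<Sum>j\<in>UNIV. ereal (sqrt (2 * lam $ j) * \<bar>M' $ i $ j\<bar>) *
                 erf_inv (2 * b $ (slack_index M' i j) $ j - 1))
              + ereal (M' $ i \<bullet> \<mu>') \<le> ereal (m $ i)"
    using assms(11) by (simp_all add: deterministic_problem_def M'_def \<mu>'_def)
  have \<phi>_meas [measurable]: "\<phi> x \<in> borel_measurable P"
    using assms(8)[of x] by (simp add: normal_distributed_vec_def)
  have law: "distr P borel (\<phi> x) = distr std_normal_vec borel (\<lambda>w. \<mu> x + (\<theta> ** D) *v w)"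
    and lam_nonneg: "\<And>j. 0 \<le> lam $ j"
    unfolding D_def by (rule distr_normal_distributed_vec_eigenbasis[OF assms(8-10)])+
  have affine [measurable]: "(\<lambda>w. \<mu> x + (\<theta> ** D) *v w) \<in> measurable std_normal_vec borel"
    using affine_borel[of "\<mu> x" "\<theta> ** D"] by (simp add: std_normal_vec_def)
  have "P.prob {\<omega> \<in> space P. M *v \<phi> x \<omega> \<le> m} = measure (distr P borel (\<phi> x)) {y. M *v y \<le> m}"
    by (subst measure_distr)
       (auto simp: sets_borel_polyhedron \<phi>_meas intro!: arg_cong[of _ _ P.prob])
  also have "\<dots> = N.prob {w. M *v (\<mu> x + (\<theta> ** D) *v w) \<le> m}"
    unfolding law by (subst measure_distr)
      (simp_all only: affine sets_borel_polyhedron, simp add: std_normal_vec_def vimage_def)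
  finally have prob_eq:
    "P.prob {\<omega> \<in> space P. M *v \<phi> x \<omega> \<le> m} = N.prob {w. M *v (\<mu> x + (\<theta> ** D) *v w) \<le> m}" .
  have event: "{w. M *v (\<mu> x + (\<theta> ** D) *v w) \<le> m} \<in> sets std_normal_vec"
    using measurable_sets[OF affine sets_borel_polyhedron[of M m]]
    by (simp add: std_normal_vec_def vimage_def)
  have box: "{w. \<forall>j. w $ j \<in> I j} \<subseteq> {w. M *v (\<mu> x + (\<theta> ** D) *v w) \<le> m}"
  proof (clarsimp simp: less_eq_vec_def)
    fix w i assume w: "\<forall>j. w $ j \<in> I j"
    \<comment> \<open>The comparison is made in \<open>ereal\<close>, term by term, so that infinite quantiles need no case split:
      an infinite bound on \<open>w $ j\<close> with coefficient \<open>0\<close> contributes \<open>0\<close> on both sides.\<close>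
    have entry: "ereal (M' $ i $ j * (sqrt (lam $ j) * w $ j))
        \<le> ereal (sqrt (2 * lam $ j) * \<bar>M' $ i $ j\<bar>) * erf_inv (2 * b $ (slack_index M' i j) $ j - 1)" for j
    proof -
      let ?s = "slack_index M' i j"
      define c where "c = sqrt (lam $ j) * \<bar>M' $ i $ j\<bar>"
      \<comment> \<open>The signed coordinate whose upper bound is the face that \<open>slack_index\<close> selects.\<close>
      define v where "v = (if 0 \<le> M' $ i $ j then w $ j else - w $ j)"
      have "0 \<le> c" by (simp add: c_def lam_nonneg)
      have "ereal v \<le> q ?s j"
        using w by (auto simp: v_def I_def slack_index_def)
      then have "ereal c * ereal v \<le> ereal c * q ?s j"
        using \<open>0 \<le> c\<close> by (intro ereal_mult_left_mono) auto
      moreover have "M' $ i $ j * (sqrt (lam $ j) * w $ j) = c * v"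
        by (simp add: c_def v_def)
      moreover have "ereal c * q ?s j = ereal (sqrt (2 * lam $ j) * \<bar>M' $ i $ j\<bar>) * erf_inv (2 * b $ ?s $ j - 1)"
      proof -
        have "ereal (sqrt (2 * lam $ j) * \<bar>M' $ i $ j\<bar>) = ereal c * ereal (sqrt 2)"
          by (simp add: c_def real_sqrt_mult mult_ac)
        then show ?thesis by (simp only: q_def mult.assoc)
      qed
      ultimately show ?thesis by simp
    qed
    have "(M *v (\<mu> x + (\<theta> ** D) *v w)) $ i = (M' *v (D *v w)) $ i + (M' *v \<mu>') $ i"
    proof -
      have "\<theta> ** transpose \<theta> = mat 1"
        using assms(9) by (simp add: matrix_left_right_inverse)
      then have "M = M' ** transpose \<theta>"
        by (simp only: M'_def flip: matrix_mul_assoc) simp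
      then have "M *v \<mu> x = M' *v \<mu>'"
        by (simp only: \<mu>'_def matrix_vector_mul_assoc)
      then show ?thesis
        by (simp add: M'_def matrix_vector_right_distrib matrix_vector_mul_assoc matrix_mul_assoc)
    qed
    also have "\<dots> = (\<Sum>j\<in>UNIV. M' $ i $ j * (sqrt (lam $ j) * w $ j)) + M' $ i \<bullet> \<mu>'"
      by (simp add: matrix_vector_mult_def[of M'] D_def diag_mult_vec inner_vec_def)
    finally have "ereal ((M *v (\<mu> x + (\<theta> ** D) *v w)) $ i)
      = (\<Sum>j\<in>UNIV. ereal (M' $ i $ j * (sqrt (lam $ j) * w $ j))) + ereal (M' $ i \<bullet> \<mu>')"
      by simp
    also have "\<dots> \<le> ereal (m $ i)"
      by (rule order_trans[OF add_right_mono[OF sum_mono] linear]) (rule entry)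
    finally show "(M *v (\<mu> x + (\<theta> ** D) *v w)) $ i \<le> m $ i" by simp
  qed
  have [measurable]: "I j \<in> sets borel" for j unfolding I_def by measurable
  have "\<beta> \<le> (\<Prod>j\<in>UNIV. b $ 1 $ j + b $ 2 $ j - 1)" by (rule slack_prod)
  also have "\<dots> \<le> (\<Prod>j\<in>UNIV. measure std_normal_distribution (I j))"
    unfolding I_def q_def using slack_sum slack_bounds
    by (intro prod_mono) (simp add: measure_std_normal_two_sided_quantile)
  also have "\<dots> = N.prob {w. \<forall>j. w $ j \<in> I j}"
    by (simp add: measure_std_normal_vec_product)
  also have "\<dots> \<le> N.prob {w. M *v (\<mu> x + (\<theta> ** D) *v w) \<le> m}"
    using box event by (rule N.finite_measure_mono)
  finally show ?thesis
    by (simp add: chance_constrained_problem_def prob_eq)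
qed

end
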